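(* Let $1\le p<\infty$. (1) If $\Omega_1,\Omega_2\subset\mathbb{C}^n$ are Reinhardt domains, then $S_p(\Omega_1\cup\Omega_2)=S_p(\Omega_1)\cap S_p(\Omega_2)$. (2) If $\Omega_1,\Omega_2\subset\mathbb{C}^n$ are Reinhardt domains, then $S_p(\Omega_1)\cup S_p(\Omega_2)\subset S_p(\Omega_1\cap\Omega_2)$. (3) If $\Omega_1\subset\mathbb{C}^{n_1}$ and $\Omega_2\subset\mathbb{C}^{n_2}$ are Reinhardt domains, then $S_p(\Omega_1\times\Omega_2)=S_p(\Omega_1)\times S_p(\Omega_2)$, where $\mathbb{Z}^{n_1+n_2}$ is identified with $\mathbb{Z}^{n_1}\times\mathbb{Z}^{n_2}$.
   Context: A domain is a non-empty connected open set. A domain $\Omega\subset\mathbb{C}^n$ is Reinhardt if $(z_1,\dots,z_n)\in\Omega$ implies $(e^{i\tau_1}z_1,\dots,e^{i\tau_n}z_n)\in\Omega$ for all $(\tau_1,\dots,\tau_n)\in\mathbb{R}^n$. For an open set $\Omega\subset\mathbb{C}^n$ and $1\le p<\infty$, $A^p(\Omega)$ denotes the space of holomorphic functions $f$ on $\Omega$ with $\int_\Omega|f|^p\,dV<\infty$, where $dV$ is Lebesgue measure. For $\alpha\in\mathbb{Z}^n$, $e_\alpha(z):=z_1^{\alpha_1}\cdots z_n^{\alpha_n}$ (a Laurent monomial if some exponents are negative), and $S_p(\Omega):=\{\alpha\in\mathbb{Z}^n: e_\alpha\in A^p(\Omega)\}$. *)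

theory Defs
  imports "HOL-Analysis.Analysis"
begin

definition is_domain :: "'a::topological_space set \<Rightarrow> bool"
  where "is_domain \<Omega> \<longleftrightarrow> \<Omega> \<noteq> {} \<and> connected \<Omega> \<and> open \<Omega>"

definition reinhardt_domain :: "(complex ^ 'n) set \<Rightarrow> bool"
  where "reinhardt_domain \<Omega> \<longleftrightarrow> is_domain \<Omega> \<and>
    (\<forall>z \<in> \<Omega>. \<forall>\<tau> :: real ^ 'n. (\<chi> i. exp (\<i> * of_real (\<tau> $ i)) * z $ i) \<in> \<Omega>)"

text \<open>Holomorphy in several variables: the real total derivative exists and is complex linear.
  It is only used for open sets.\<close>

definition holomorphic_several_on :: "(complex ^ 'n \<Rightarrow> complex) \<Rightarrow> (complex ^ 'n) set \<Rightarrow> bool"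
  where "holomorphic_several_on f \<Omega> \<longleftrightarrow>
    (\<forall>z \<in> \<Omega>. \<exists>D. (f has_derivative D) (at z within \<Omega>) \<and> (\<forall>c v. D (c *s v) = c * D v))"

text \<open>Functions on \<open>\<Omega>\<close> are represented by total functions; membership in the Bergman space
  depends only on the values on \<open>\<Omega>\<close>.\<close>

definition bergman_space :: "real \<Rightarrow> (complex ^ 'n) set \<Rightarrow> (complex ^ 'n \<Rightarrow> complex) set"
  where "bergman_space p \<Omega> = {f. holomorphic_several_on f \<Omega> \<and>
    (\<integral>\<^sup>+ z \<in> \<Omega>. ennreal (cmod (f z) powr p) \<partial>lborel) < \<infinity>}"

text \<open>If some exponent \<open>\<alpha> $ i\<close> is negative, the monomial is undefined where \<open>z $ i = 0\<close>; here it
  takes the value 0 there. It is discontinuous on every open set meeting that hyperplane (being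
  unbounded near a point of it with all other coordinates nonzero), hence not holomorphic, so
  this convention does not enlarge \<open>monomial_exponents\<close>.\<close>

definition laurent_monomial :: "int ^ 'n \<Rightarrow> complex ^ 'n \<Rightarrow> complex"
  where "laurent_monomial \<alpha> z = (\<Prod>i \<in> UNIV. (z $ i) powi (\<alpha> $ i))"

definition monomial_exponents :: "real \<Rightarrow> (complex ^ 'n) set \<Rightarrow> (int ^ 'n) set"
  where "monomial_exponents p \<Omega> = {\<alpha>. laurent_monomial \<alpha> \<in> bergman_space p \<Omega>}"

text \<open>Cartesian product under the identification of pairs of vectors indexed by \<open>'m\<close> and \<open>'n\<close>
  with vectors indexed by the disjoint sum \<open>'m + 'n\<close>.\<close>

definition vec_times :: "('a ^ 'm) set \<Rightarrow> ('a ^ 'n) set \<Rightarrow> ('a ^ ('m + 'n)) set"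
  where "vec_times A B = {v. (\<chi> i. v $ Inl i) \<in> A \<and> (\<chi> j. v $ Inr j) \<in> B}"

end

theory Submission
  imports Defs
begin

text \<open>Unions and intersections only need that holomorphy is local and that the integral is monotone
  and subadditive. A monomial on a product domain factors into a monomial in the first block of
  variables and one in the second, so by Tonelli its \<open>p\<close>-th power integral is the product of the two
  integrals. Neither of them vanishes, as every non-empty open set has an open non-empty part without
  zero coordinates; hence the product is finite exactly if both are. Holomorphy of a factor follows
  by freezing the other block of variables at a point without zero coordinates.\<close>

section \<open>Holomorphy\<close>

lemma holomorphic_several_on_subset:
  "holomorphic_several_on f T \<Longrightarrow> S \<subseteq> T \<Longrightarrow> holomorphic_several_on f S"
  unfolding holomorphic_several_on_def by (meson has_derivative_subset subsetD)

text \<open>At a point of an open set, the derivative within that set is the full derivative. A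
  derivative found in \<open>S\<close> or in \<open>T\<close> therefore serves in the union as
  well.\<close>

lemma holomorphic_several_on_open_Un:
  assumes "open S" "open T" "holomorphic_several_on f S" "holomorphic_several_on f T"
  shows "holomorphic_several_on f (S \<union> T)"
  using assms unfolding holomorphic_several_on_def
  by (metis UnE at_within_open open_Un)

lemma holomorphic_several_on_mult:
  assumes "holomorphic_several_on f S" "holomorphic_several_on g S"
  shows "holomorphic_several_on (\<lambda>z. f z * g z) S"
  unfolding holomorphic_several_on_def
proof
  fix z assume "z \<in> S"
  then obtain D E where "(f has_derivative D) (at z within S)" "\<And>c v. D (c *s v) = c * D v"
    and "(g has_derivative E) (at z within S)" "\<And>c v. E (c *s v) = c * E v"
    using assms unfolding holomorphic_several_on_def by metis
  then show "\<exists>D. ((\<lambda>z. f z * g z) has_derivative D) (at z within S) \<and> (\<forall>c v. D (c *s v) = c * D v)"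
    using has_derivative_mult[of f D z S g E]
    by (intro exI[of _ "\<lambda>h. f z * E h + D h * g z"]) (simp add: distrib_left mult_ac)
qed

text \<open>Chain rule in the two cases needed later: projections to a block of variables, and
  slices that embed one block with the other one frozen at a point. Since
  \<open>bounded_linear\<close> is real linearity, homogeneity over the complex numbers is assumed
  separately.\<close>

lemma holomorphic_several_on_affine:
  assumes f: "holomorphic_several_on f T" and L: "bounded_linear L"
    and scale: "\<And>c v. L (c *s v) = c *s L v" and sub: "\<And>z. z \<in> S \<Longrightarrow> L z + b \<in> T"
  shows "holomorphic_several_on (\<lambda>z. f (L z + b)) S"
  unfolding holomorphic_several_on_def
proof
  fix z assume z: "z \<in> S"
  then obtain D where D: "(f has_derivative D) (at (L z + b) within T)"
    and Dc: "\<And>c v. D (c *s v) = c * D v"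
    using f sub unfolding holomorphic_several_on_def by metis
  have "((\<lambda>z. L z + b) has_derivative L) (at z within S)"
    using has_derivative_add_const[OF bounded_linear_imp_has_derivative[OF L]] by blast
  moreover have "(f has_derivative D) (at (L z + b) within (\<lambda>z. L z + b) ` S)"
    using D by (rule has_derivative_subset) (use sub in blast)
  ultimately have "((\<lambda>z. f (L z + b)) has_derivative (\<lambda>h. D (L h))) (at z within S)"
    by (rule has_derivative_in_compose)
  then show "\<exists>D. ((\<lambda>z. f (L z + b)) has_derivative D) (at z within S) \<and> (\<forall>c v. D (c *s v) = c * D v)"
    using Dc scale by (intro exI[of _ "\<lambda>h. D (L h)"]) auto
qed

section \<open>Vectors indexed by a disjoint sum\<close>

text \<open>With \<open>vec_left\<close> and \<open>vec_right\<close> this makes the identification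
  behind \<open>vec_times\<close> explicit. The entry type is arbitrary because points and exponent
  vectors are split by the same maps.\<close>

definition vec_join :: "'a ^ 'm \<Rightarrow> 'a ^ 'n \<Rightarrow> 'a ^ ('m::finite + 'n::finite)"
  where "vec_join x y = (\<chi> k. case k of Inl i \<Rightarrow> x $ i | Inr j \<Rightarrow> y $ j)"

definition vec_left :: "'a ^ ('m::finite + 'n::finite) \<Rightarrow> 'a ^ 'm"
  where "vec_left v = (\<chi> i. v $ Inl i)"

definition vec_right :: "'a ^ ('m::finite + 'n::finite) \<Rightarrow> 'a ^ 'n"
  where "vec_right v = (\<chi> j. v $ Inr j)"

lemma vec_join_nth [simp]:
  "vec_join x y $ Inl i = x $ i" "vec_join x y $ Inr j = y $ j"
  by (simp_all add: vec_join_def)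

lemma vec_left_nth [simp]: "vec_left v $ i = v $ Inl i"
  by (simp add: vec_left_def)

lemma vec_right_nth [simp]: "vec_right v $ j = v $ Inr j"
  by (simp add: vec_right_def)

lemma vec_left_join [simp]: "vec_left (vec_join x y) = x"
  by (simp add: vec_eq_iff)

lemma vec_right_join [simp]: "vec_right (vec_join x y) = y"
  by (simp add: vec_eq_iff)

lemma vec_sum_eq_iff:
  "(v :: 'a ^ ('m::finite + 'n::finite)) = w \<longleftrightarrow> (\<forall>i. v $ Inl i = w $ Inl i) \<and> (\<forall>j. v $ Inr j = w $ Inr j)"
  unfolding vec_eq_iff by (metis old.sum.exhaust)

lemma mem_vec_times: "v \<in> vec_times A B \<longleftrightarrow> vec_left v \<in> A \<and> vec_right v \<in> B"
  by (simp add: vec_times_def vec_left_def vec_right_def)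

lemma bounded_linear_vec_left:
  "bounded_linear (vec_left :: 'a::euclidean_space ^ ('m::finite + 'n::finite) \<Rightarrow> 'a ^ 'm)"
  unfolding linear_conv_bounded_linear[symmetric] by (rule linearI) (simp_all add: vec_eq_iff)

lemma bounded_linear_vec_right:
  "bounded_linear (vec_right :: 'a::euclidean_space ^ ('m::finite + 'n::finite) \<Rightarrow> 'a ^ 'n)"
  unfolding linear_conv_bounded_linear[symmetric] by (rule linearI) (simp_all add: vec_eq_iff)

lemma linear_vec_join:
  "linear (\<lambda>(x, y). vec_join x y :: 'a::euclidean_space ^ ('m::finite + 'n::finite))"
  by (rule linearI) (auto simp: vec_sum_eq_iff)

lemma bounded_linear_vec_join_left:
  "bounded_linear (\<lambda>x. vec_join x 0 :: 'a::euclidean_space ^ ('m::finite + 'n::finite))"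
  unfolding linear_conv_bounded_linear[symmetric] by (rule linearI) (simp_all add: vec_sum_eq_iff)

lemma bounded_linear_vec_join_right:
  "bounded_linear (\<lambda>y. vec_join 0 y :: 'a::euclidean_space ^ ('m::finite + 'n::finite))"
  unfolding linear_conv_bounded_linear[symmetric] by (rule linearI) (simp_all add: vec_sum_eq_iff)

lemma prod_UNIV_sum:
  fixes f :: "'m::finite + 'n::finite \<Rightarrow> 'a::comm_monoid_mult"
  shows "(\<Prod>k\<in>UNIV. f k) = (\<Prod>i\<in>UNIV. f (Inl i)) * (\<Prod>j\<in>UNIV. f (Inr j))"
  by (subst UNIV_Plus_UNIV[symmetric], subst prod.Plus) simp_all

lemma sum_UNIV_sum:
  fixes f :: "'m::finite + 'n::finite \<Rightarrow> 'a::comm_monoid_add"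
  shows "(\<Sum>k\<in>UNIV. f k) = (\<Sum>i\<in>UNIV. f (Inl i)) + (\<Sum>j\<in>UNIV. f (Inr j))"
  by (subst UNIV_Plus_UNIV[symmetric], subst sum.Plus) simp_all

lemma inner_vec_join:
  "vec_join x y \<bullet> v = x \<bullet> vec_left v + y \<bullet> vec_right v"
  by (simp add: inner_vec_def sum_UNIV_sum)

section \<open>Lebesgue measure on a product\<close>

text \<open>Such a map only relabels coordinates, so the preimage of a box is a box with the same
  side lengths, and Lebesgue measure is determined by its values on boxes. Domain and codomain are
  different types so that the domain can be a product type.\<close>

lemma distr_lborel_orthonormal:
  fixes f :: "'a::euclidean_space \<Rightarrow> 'b::euclidean_space"
  assumes lin: "linear f" and bij: "bij_betw f Basis Basis"
    and inner: "\<And>x y. f x \<bullet> f y = x \<bullet> y"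
  shows "distr lborel borel f = lborel"
proof (rule lborel_eqI[symmetric])
  have meas: "f \<in> borel_measurable borel"
    using lin by (intro borel_measurable_continuous_onI linear_continuous_on)
      (simp add: linear_conv_bounded_linear)
  fix l u :: 'b assume le: "\<And>b. b \<in> Basis \<Longrightarrow> l \<bullet> b \<le> u \<bullet> b"
  \<comment> \<open>The relabelling in the other direction: coordinate \<open>b\<close> of
    \<open>g v\<close> is coordinate \<open>f b\<close> of \<open>v\<close>. Thus \<open>g l\<close>
    and \<open>g u\<close> are the corners of the preimage box.\<close>
  define g :: "'b \<Rightarrow> 'a" where "g v = (\<Sum>b\<in>Basis. (v \<bullet> f b) *\<^sub>R b)" for v
  have g: "g v \<bullet> b = v \<bullet> f b" if "b \<in> Basis" for v b
    using that by (simp add: g_def)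
  have im: "f ` Basis = Basis"
    using bij by (simp add: bij_betw_def)
  have "f -` box l u = box (g l) (g u)"
    unfolding box_def by (subst im[symmetric]) (auto simp: g inner)
  moreover have "\<And>b. b \<in> Basis \<Longrightarrow> g l \<bullet> b \<le> g u \<bullet> b"
    using le im by (auto simp: g)
  moreover have "(\<Prod>b\<in>Basis. (g u - g l) \<bullet> b) = (\<Prod>b\<in>Basis. (u - l) \<bullet> b)"
    by (subst prod.reindex_bij_betw[OF bij, symmetric]) (simp add: g inner_diff_left)
  ultimately show "emeasure (distr lborel borel f) (box l u) = (\<Prod>b\<in>Basis. (u - l) \<bullet> b)"
    using meas by (simp add: emeasure_distr emeasure_lborel_box)
qed simp

text \<open>The basis vectors of the product are the pairs \<open>(axis i b, 0)\<close> and
  \<open>(0, axis j b)\<close>; joining turns them into \<open>axis (Inl i) b\<close> and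
  \<open>axis (Inr j) b\<close>, which exhaust the basis of the joined space.\<close>

lemma distr_lborel_vec_join:
  "distr lborel borel (\<lambda>(x, y). vec_join x y) = (lborel :: ('a::euclidean_space ^ ('m::finite + 'n::finite)) measure)"
proof (rule distr_lborel_orthonormal)
  let ?f = "\<lambda>(x, y). vec_join x y :: 'a ^ ('m::finite + 'n::finite)"
  have eq: "vec_join (axis i b) 0 = (axis (Inl i) b :: 'a ^ ('m + 'n))"
    "vec_join 0 (axis j b) = (axis (Inr j) b :: 'a ^ ('m + 'n))"
    for i :: 'm and j :: 'n and b :: 'a
    by (auto simp: vec_sum_eq_iff axis_def)
  have "?f ` Basis = Basis"
  proof
    show "?f ` Basis \<subseteq> Basis"
      unfolding Basis_prod_def by (auto simp: Basis_vec_def eq) blast+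
    show "Basis \<subseteq> ?f ` Basis"
    proof
      fix v :: "'a ^ ('m::finite + 'n::finite)" assume "v \<in> Basis"
      then obtain k b where v: "v = axis k b" "b \<in> Basis"
        by (auto simp: Basis_vec_def)
      show "v \<in> ?f ` Basis"
      proof (cases k)
        case (Inl i)
        then have "v = ?f (axis i b, 0)" using v eq by simp
        moreover have "(axis i b, 0) \<in> Basis" using v by (auto simp: Basis_prod_def Basis_vec_def)
        ultimately show ?thesis by blast
      next
        case (Inr j)
        then have "v = ?f (0, axis j b)" using v eq by simp
        moreover have "(0, axis j b) \<in> Basis" using v by (auto simp: Basis_prod_def Basis_vec_def)
        ultimately show ?thesis by blast
      qed
    qed
  qed
  moreover have "inj_on ?f Basis"
    by (auto simp: inj_on_def vec_sum_eq_iff vec_eq_iff)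
  ultimately show "bij_betw ?f Basis Basis"
    by (simp add: bij_betw_def)
qed (auto simp: linear_vec_join inner_vec_join)

text \<open>Tonelli for the two blocks of coordinates, after transporting the integral to the
  product measure along \<open>vec_join\<close>.\<close>

lemma nn_integral_lborel_vec_join:
  fixes f :: "'a::euclidean_space ^ ('m::finite + 'n::finite) \<Rightarrow> ennreal"
  assumes [measurable]: "f \<in> borel_measurable borel"
  shows "(\<integral>\<^sup>+ v. f v \<partial>lborel) = (\<integral>\<^sup>+ x. \<integral>\<^sup>+ y. f (vec_join x y) \<partial>lborel \<partial>lborel)"
proof -
  have [measurable]: "(\<lambda>(x, y). vec_join x y :: 'a ^ ('m::finite + 'n::finite)) \<in> borel_measurable (borel \<Otimes>\<^sub>M borel)"
    unfolding borel_prod using linear_vec_join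
    by (intro borel_measurable_continuous_onI linear_continuous_on)
      (simp add: linear_conv_bounded_linear)
  have "(\<integral>\<^sup>+ v. f v \<partial>lborel) = (\<integral>\<^sup>+ v. f v \<partial>distr (lborel \<Otimes>\<^sub>M lborel) borel (\<lambda>(x, y). vec_join x y))"
    by (simp only: lborel_prod distr_lborel_vec_join)
  also have "\<dots> = (\<integral>\<^sup>+ z. f (case z of (x, y) \<Rightarrow> vec_join x y) \<partial>(lborel \<Otimes>\<^sub>M lborel))"
    by (rule nn_integral_distr) measurable
  also have "\<dots> = (\<integral>\<^sup>+ x. \<integral>\<^sup>+ y. f (vec_join x y) \<partial>lborel \<partial>lborel)"
    using lborel.nn_integral_fst[of "\<lambda>z. f (case z of (x, y) \<Rightarrow> vec_join x y)" lborel] by simp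
  finally show ?thesis .
qed

section \<open>Laurent monomials\<close>

lemma open_nonzero_coordinates: "open {z :: complex ^ 'n. \<forall>i. z $ i \<noteq> 0}"
proof -
  have "{z :: complex ^ 'n. \<forall>i. z $ i \<noteq> 0} = (\<Inter>i. {z. z $ i \<noteq> 0})"
    by auto
  moreover have "open {z :: complex ^ 'n. z $ i \<noteq> 0}" for i
    by (intro open_Collect_neq continuous_intros)
  ultimately show ?thesis
    by (simp add: open_INT)
qed

text \<open>Move from a point \<open>a\<close> of the set along the diagonal. The parameters
  \<open>t\<close> that stay inside form an open neighbourhood of 0 in the plane, hence an infinite
  set, while only the finitely many values \<open>- a $ i\<close> make a coordinate vanish.\<close>

lemma open_meets_nonzero_coordinates:
  fixes \<Omega> :: "(complex ^ 'n) set"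
  assumes "open \<Omega>" "\<Omega> \<noteq> {}"
  obtains z where "z \<in> \<Omega>" "\<And>i. z $ i \<noteq> 0"
proof -
  obtain a where a: "a \<in> \<Omega>" using assms by blast
  define T where "T = (\<lambda>t :: complex. a + (\<chi> i. t)) -` \<Omega>"
  have "open T"
    unfolding T_def using \<open>open \<Omega>\<close> by (intro open_vimage continuous_intros)
  moreover have "0 \<in> T"
    using a by (simp add: T_def zero_vec_def[symmetric])
  ultimately have "infinite T"
    using finite_imp_not_open by blast
  then obtain t where "t \<in> T" "t \<notin> range (\<lambda>i. - a $ i)"
    by (meson finite finite_imageI finite_subset subsetI)
  then have "a + (\<chi> i. t) \<in> \<Omega>" "(a + (\<chi> i. t)) $ i \<noteq> 0" for i
    by (auto simp: T_def add_eq_0_iff)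
  then show ?thesis by (rule that)
qed

lemma laurent_monomial_nonzero: "(\<And>i. z $ i \<noteq> 0) \<Longrightarrow> laurent_monomial \<alpha> z \<noteq> 0"
  by (simp add: laurent_monomial_def)

lemma laurent_monomial_vec_sum:
  "laurent_monomial \<alpha> z
    = laurent_monomial (vec_left \<alpha>) (vec_left z) * laurent_monomial (vec_right \<alpha>) (vec_right z)"
  by (simp add: laurent_monomial_def prod_UNIV_sum)

lemma borel_measurable_laurent_monomial [measurable]:
  "laurent_monomial \<alpha> \<in> borel_measurable borel"
proof -
  have [measurable]: "(\<lambda>z :: complex ^ 'n. z $ i) \<in> borel_measurable borel" for i
    by (intro borel_measurable_continuous_onI continuous_intros)
  \<comment> \<open>For negative \<open>k\<close> this is a natural power of the inverse, which is
    Borel on the whole plane with the value 0 at 0.\<close>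
  have "(\<lambda>z :: complex ^ 'n. (z $ i) powi k) \<in> borel_measurable borel" for i k
    by (cases "k \<ge> 0") (simp_all add: power_int_def)
  then show ?thesis
    unfolding laurent_monomial_def[abs_def] by measurable
qed

text \<open>Isolates the integrability half of membership, so that it can be treated apart from
  holomorphy.\<close>

definition monomial_integral :: "real \<Rightarrow> int ^ 'n \<Rightarrow> (complex ^ 'n) set \<Rightarrow> ennreal"
  where "monomial_integral p \<alpha> \<Omega> = (\<integral>\<^sup>+ z \<in> \<Omega>. ennreal (cmod (laurent_monomial \<alpha> z) powr p) \<partial>lborel)"

lemma mem_monomial_exponents:
  "\<alpha> \<in> monomial_exponents p \<Omega> \<longleftrightarrow>
    holomorphic_several_on (laurent_monomial \<alpha>) \<Omega> \<and> monomial_integral p \<alpha> \<Omega> < \<infinity>"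
  by (simp add: monomial_exponents_def bergman_space_def monomial_integral_def)

lemma monomial_integral_mono: "S \<subseteq> T \<Longrightarrow> monomial_integral p \<alpha> S \<le> monomial_integral p \<alpha> T"
  unfolding monomial_integral_def by (intro nn_set_integral_set_mono)

lemma monomial_integral_Un_le:
  assumes [measurable]: "S \<in> sets borel" "T \<in> sets borel"
  shows "monomial_integral p \<alpha> (S \<union> T) \<le> monomial_integral p \<alpha> S + monomial_integral p \<alpha> T"
proof -
  have "monomial_integral p \<alpha> (S \<union> T) \<le>
      (\<integral>\<^sup>+ z. ennreal (cmod (laurent_monomial \<alpha> z) powr p) * indicator S z
        + ennreal (cmod (laurent_monomial \<alpha> z) powr p) * indicator T z \<partial>lborel)"
    unfolding monomial_integral_def by (intro nn_integral_mono) (auto simp: indicator_def)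
  also have "\<dots> = monomial_integral p \<alpha> S + monomial_integral p \<alpha> T"
    unfolding monomial_integral_def by (rule nn_integral_add) measurable
  finally show ?thesis .
qed

text \<open>The monomial is nonzero on the non-empty open part of the set without zero coordinates.
  A vanishing integral would make that part a null set, which no non-empty open set is.\<close>

lemma monomial_integral_nonzero:
  fixes \<Omega> :: "(complex ^ 'n) set"
  assumes "open \<Omega>" "\<Omega> \<noteq> {}"
  shows "monomial_integral p \<alpha> \<Omega> \<noteq> 0"
proof
  assume zero: "monomial_integral p \<alpha> \<Omega> = 0"
  define U where "U = \<Omega> \<inter> {z. \<forall>i. z $ i \<noteq> 0}"
  have "open U"
    unfolding U_def using assms open_nonzero_coordinates by blast
  have "U \<noteq> {}"
    unfolding U_def by (rule open_meets_nonzero_coordinates[OF assms]) blast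
  have [measurable]: "\<Omega> \<in> sets borel" "U \<in> sets borel"
    using \<open>open \<Omega>\<close> \<open>open U\<close> by auto
  have "AE z in lborel. ennreal (cmod (laurent_monomial \<alpha> z) powr p) * indicator \<Omega> z = 0"
    using zero unfolding monomial_integral_def by (subst (asm) nn_integral_0_iff_AE) auto
  then have "AE z in lborel. z \<notin> U"
    by eventually_elim (use laurent_monomial_nonzero[of _ \<alpha>] in \<open>auto simp: U_def\<close>)
  then have "U \<in> null_sets lborel"
    by (subst (asm) AE_iff_null_sets[symmetric]) auto
  then have "negligible U"
    by (simp add: negligible_iff_null_sets null_sets_completionI)
  then show False
    using \<open>open U\<close> \<open>U \<noteq> {}\<close> open_not_negligible by blast
qed

lemma monomial_integral_vec_times:
  assumes [measurable]: "A \<in> sets borel" "B \<in> sets borel" "vec_times A B \<in> sets borel"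
  shows "monomial_integral p \<alpha> (vec_times A B)
    = monomial_integral p (vec_left \<alpha>) A * monomial_integral p (vec_right \<alpha>) B"
proof -
  let ?F = "\<lambda>x. ennreal (cmod (laurent_monomial (vec_left \<alpha>) x) powr p) * indicator A x"
  let ?G = "\<lambda>y. ennreal (cmod (laurent_monomial (vec_right \<alpha>) y) powr p) * indicator B y"
  have "monomial_integral p \<alpha> (vec_times A B) = (\<integral>\<^sup>+ x. \<integral>\<^sup>+ y. ?F x * ?G y \<partial>lborel \<partial>lborel)"
    unfolding monomial_integral_def
    \<comment> \<open>Monomial, modulus, \<open>p\<close>-th power and the indicator of the product
      set all split into a factor in \<open>x\<close> and a factor in \<open>y\<close>.\<close>
    by (subst nn_integral_lborel_vec_join, measurable)
      (auto intro!: nn_integral_cong simp: laurent_monomial_vec_sum[of \<alpha>] norm_mult powr_mult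
        ennreal_mult mem_vec_times indicator_def)
  also have "\<dots> = (\<integral>\<^sup>+ x. ?F x * (\<integral>\<^sup>+ y. ?G y \<partial>lborel) \<partial>lborel)"
    by (subst nn_integral_cmult) auto
  also have "\<dots> = monomial_integral p (vec_left \<alpha>) A * monomial_integral p (vec_right \<alpha>) B"
    unfolding monomial_integral_def by (subst nn_integral_multc) auto
  finally show ?thesis .
qed

lemma open_vec_times:
  fixes A :: "('a::euclidean_space ^ 'm) set" and B :: "('a ^ 'n) set"
  assumes "open A" "open B"
  shows "open (vec_times A B)"
proof -
  have "vec_times A B = vec_left -` A \<inter> vec_right -` B"
    by (auto simp: mem_vec_times)
  then show ?thesis
    using assms by (auto intro!: open_Int open_vimage linear_continuous_on
        bounded_linear_vec_left bounded_linear_vec_right)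
qed

lemma holomorphic_laurent_monomial_vec_times_iff:
  fixes A :: "(complex ^ 'm) set" and B :: "(complex ^ 'n) set"
  assumes "open A" "A \<noteq> {}" "open B" "B \<noteq> {}"
  shows "holomorphic_several_on (laurent_monomial \<alpha>) (vec_times A B) \<longleftrightarrow>
    holomorphic_several_on (laurent_monomial (vec_left \<alpha>)) A \<and>
    holomorphic_several_on (laurent_monomial (vec_right \<alpha>)) B"
    (is "?P \<longleftrightarrow> ?Q \<and> ?R")
proof
  assume P: ?P
  have const: "holomorphic_several_on (\<lambda>z. c) S" for c and S :: "(complex ^ 'k) set"
    unfolding holomorphic_several_on_def by (auto intro!: exI[of _ "\<lambda>_. 0"])
  obtain a where a: "a \<in> A" "\<And>i. a $ i \<noteq> 0"
    using open_meets_nonzero_coordinates assms by blast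
  obtain b where b: "b \<in> B" "\<And>i. b $ i \<noteq> 0"
    using open_meets_nonzero_coordinates assms by blast
  have join: "vec_join x 0 + vec_join 0 y = vec_join x y"
    for x :: "complex ^ 'm" and y :: "complex ^ 'n"
    by (simp add: vec_sum_eq_iff)
  \<comment> \<open>The slice through \<open>b\<close>, written as a linear part plus a
    translation.\<close>
  have "holomorphic_several_on (\<lambda>x. laurent_monomial \<alpha> (vec_join x 0 + vec_join 0 b)) A"
    using P by (rule holomorphic_several_on_affine)
      (use b in \<open>auto simp: bounded_linear_vec_join_left join mem_vec_times vec_sum_eq_iff\<close>)
  \<comment> \<open>On the slice the second factor is a constant, nonzero by the choice of
    \<open>b\<close>; dividing by it leaves the monomial in the first block.\<close>
  from holomorphic_several_on_mult[OF this const[of "inverse (laurent_monomial (vec_right \<alpha>) b)"]]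
  have ?Q
    using laurent_monomial_nonzero[of b] b by (simp add: join laurent_monomial_vec_sum[of \<alpha>] mult.assoc)
  have "holomorphic_several_on (\<lambda>y. laurent_monomial \<alpha> (vec_join 0 y + vec_join a 0)) B"
    using P by (rule holomorphic_several_on_affine)
      (use a in \<open>auto simp: bounded_linear_vec_join_right join add.commute[of "vec_join 0 _"]
        mem_vec_times vec_sum_eq_iff\<close>)
  from holomorphic_several_on_mult[OF const[of "inverse (laurent_monomial (vec_left \<alpha>) a)"] this]
  have ?R
    using laurent_monomial_nonzero[of a] a
    by (simp add: join add.commute[of "vec_join 0 _"] laurent_monomial_vec_sum[of \<alpha>]
        mult.assoc[symmetric])
  show "?Q \<and> ?R" using \<open>?Q\<close> \<open>?R\<close> by blast
next
  assume QR: "?Q \<and> ?R"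
  \<comment> \<open>Conversely, each factor is pulled back along its projection, an affine map with
    translation 0, and the two are multiplied.\<close>
  have "holomorphic_several_on (\<lambda>z. laurent_monomial (vec_left \<alpha>) (vec_left z + 0)) (vec_times A B)"
    using QR[THEN conjunct1] by (rule holomorphic_several_on_affine)
      (auto simp: bounded_linear_vec_left mem_vec_times vec_eq_iff)
  moreover have "holomorphic_several_on (\<lambda>z. laurent_monomial (vec_right \<alpha>) (vec_right z + 0)) (vec_times A B)"
    using QR[THEN conjunct2] by (rule holomorphic_several_on_affine)
      (auto simp: bounded_linear_vec_right mem_vec_times vec_eq_iff)
  ultimately have "holomorphic_several_on (\<lambda>z. laurent_monomial \<alpha> z) (vec_times A B)"
    unfolding laurent_monomial_vec_sum[of \<alpha>] using holomorphic_several_on_mult by fastforce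
  then show ?P by simp
qed

section \<open>Exponent sets\<close>

text \<open>Yields the second claim and the easy inclusion of the first. It covers an intersection
  that is empty or disconnected and so not a domain.\<close>

lemma monomial_exponents_antimono:
  "S \<subseteq> T \<Longrightarrow> monomial_exponents p T \<subseteq> monomial_exponents p S"
  unfolding mem_monomial_exponents subset_iff
  by (meson holomorphic_several_on_subset le_less_trans monomial_integral_mono subset_iff)

lemma monomial_exponents_Un:
  assumes "open S" "open T"
  shows "monomial_exponents p (S \<union> T) = monomial_exponents p S \<inter> monomial_exponents p T"
proof
  show "monomial_exponents p (S \<union> T) \<subseteq> monomial_exponents p S \<inter> monomial_exponents p T"
    by (simp add: monomial_exponents_antimono)
  show "monomial_exponents p S \<inter> monomial_exponents p T \<subseteq> monomial_exponents p (S \<union> T)"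
  proof
    fix \<alpha> assume "\<alpha> \<in> monomial_exponents p S \<inter> monomial_exponents p T"
    then have "holomorphic_several_on (laurent_monomial \<alpha>) (S \<union> T)"
      and "monomial_integral p \<alpha> S + monomial_integral p \<alpha> T < \<infinity>"
      using assms by (simp_all add: mem_monomial_exponents holomorphic_several_on_open_Un)
    then show "\<alpha> \<in> monomial_exponents p (S \<union> T)"
      using assms monomial_integral_Un_le[of S T p \<alpha>]
      by (simp add: mem_monomial_exponents order_le_less_trans)
  qed
qed

lemma monomial_exponents_vec_times:
  fixes A :: "(complex ^ 'm) set" and B :: "(complex ^ 'n) set"
  assumes "open A" "A \<noteq> {}" "open B" "B \<noteq> {}"
  shows "monomial_exponents p (vec_times A B)
    = vec_times (monomial_exponents p A) (monomial_exponents p B)"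
proof -
  \<comment> \<open>In \<open>ennreal\<close> the product of 0 and infinity is 0, so a finite
    product gives two finite factors only once both are known to be nonzero.\<close>
  have "monomial_integral p \<alpha> (vec_times A B) < \<infinity> \<longleftrightarrow>
      monomial_integral p (vec_left \<alpha>) A < \<infinity> \<and> monomial_integral p (vec_right \<alpha>) B < \<infinity>" for \<alpha>
    using assms monomial_integral_nonzero[of A p] monomial_integral_nonzero[of B p]
    by (subst monomial_integral_vec_times)
      (auto simp: open_vec_times ennreal_mult_less_top less_top ennreal_mult_eq_top_iff)
  then show ?thesis
    using holomorphic_laurent_monomial_vec_times_iff[OF assms]
    by (auto simp: mem_monomial_exponents mem_vec_times)
qed

theorem proposition5p1:
  fixes p :: real
  assumes "1 \<le> p"
  shows "(\<forall>\<Omega>\<^sub>1 \<Omega>\<^sub>2 :: (complex ^ 'n) set. reinhardt_domain \<Omega>\<^sub>1 \<longrightarrow> reinhardt_domain \<Omega>\<^sub>2 \<longrightarrow>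
        monomial_exponents p (\<Omega>\<^sub>1 \<union> \<Omega>\<^sub>2) = monomial_exponents p \<Omega>\<^sub>1 \<inter> monomial_exponents p \<Omega>\<^sub>2)
    \<and> (\<forall>\<Omega>\<^sub>1 \<Omega>\<^sub>2 :: (complex ^ 'n) set. reinhardt_domain \<Omega>\<^sub>1 \<longrightarrow> reinhardt_domain \<Omega>\<^sub>2 \<longrightarrow>
        monomial_exponents p \<Omega>\<^sub>1 \<union> monomial_exponents p \<Omega>\<^sub>2 \<subseteq> monomial_exponents p (\<Omega>\<^sub>1 \<inter> \<Omega>\<^sub>2))
    \<and> (\<forall>(\<Omega>\<^sub>1 :: (complex ^ 'n1) set) (\<Omega>\<^sub>2 :: (complex ^ 'n2) set).
        reinhardt_domain \<Omega>\<^sub>1 \<longrightarrow> reinhardt_domain \<Omega>\<^sub>2 \<longrightarrow>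
        monomial_exponents p (vec_times \<Omega>\<^sub>1 \<Omega>\<^sub>2)
          = vec_times (monomial_exponents p \<Omega>\<^sub>1) (monomial_exponents p \<Omega>\<^sub>2))"
  \<comment> \<open>The first and third claims are rewriting. For the second, \<open>rotated\<close>
    makes membership the major premise, leaving the inclusion of the intersection in each
    domain.\<close>
  by (auto simp: reinhardt_domain_def is_domain_def monomial_exponents_Un
      monomial_exponents_vec_times dest: subsetD[OF monomial_exponents_antimono, rotated])

end
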